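(* Let $n\ge 1$ and $k\ge 1$ be integers and let $L(X)=\sum_{i=0}^k b_iX^{2^i}$ with $b_i\in\mathbb F_2$ for all $i$ and $b_k=1$. Let $A$ be the $k\times k$ matrix over $\mathbb F_2$ whose entries are $A_{i+1,i}=1$ for $1\le i\le k-1$, $A_{i+1,k}=b_i$ for $0\le i\le k-1$, and all other entries $0$ (the companion matrix). Then $L(X)$ splits completely over $\mathbb F_{2^n}$ and has simple zeros (i.e. $L(X)=\prod_{u\in E_k}(X+u)$ for some $k$-dimensional $\mathbb F_2$-linear subspace $E_k$ of $\mathbb F_{2^n}$) if and only if $A^n=I_k$; this is equivalent to the condition that the polynomial $P(X)=\sum_{i=0}^k b_iX^i\in\mathbb F_2[X]$ divides $X^n+1$. Consequently, if $X^n+1$ has a factor in $\mathbb F_2[X]$ of the form $X^k+a_{k-1}X^{k-1}+\cdots+a_2X^2+a_0$ (i.e. with zero coefficient of $X$), then $F_{\mathrm{inv}}$ is not $k$th order sum-free.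
   Context: $F_{\mathrm{inv}}:\mathbb F_{2^n}\to\mathbb F_{2^n}$ is defined by $F_{\mathrm{inv}}(x)=x^{2^n-2}$ (so $F_{\mathrm{inv}}(x)=x^{-1}$ for $x\ne0$ and $F_{\mathrm{inv}}(0)=0$). A function $F:\mathbb F_{2^n}\to\mathbb F_{2^n}$ is called $k$th order sum-free if $\sum_{x\in A}F(x)\ne 0$ for every $k$-dimensional affine $\mathbb F_2$-subspace $A$ of $\mathbb F_{2^n}$. $I_k$ denotes the $k\times k$ identity matrix. *)

theory Defs
  imports
    "HOL-Library.Z2"
    "HOL-Library.Cardinality"
    "HOL-Library.Multiset"
    "HOL-Computational_Algebra.Polynomial"
    "Jordan_Normal_Form.Matrix"
begin

text \<open>
  The prime field F2 is the type \<^typ>\<open>bit\<close>.  The field with \<open>2 ^ n\<close> elements is an arbitrary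
  type \<open>'a :: {field, finite}\<close> with \<open>CARD('a) = 2 ^ n\<close>, into which F2 embeds by \<^const>\<open>of_bool\<close>
  (abbreviated \<open>of_bit\<close> in \<^theory>\<open>HOL-Library.Z2\<close>).
\<close>

definition f2_scale :: "bit \<Rightarrow> 'a::field \<Rightarrow> 'a" where
  "f2_scale c x = of_bit c * x"

text \<open>This is an F2-vector space structure, so the library notions of subspace and
  dimension used below have their intended meaning.\<close>

lemma two_eq_zero_card:
  assumes "CARD('a::{field,finite}) = 2 ^ n"
  shows "(2::'a) = 0"
proof -
  have "(\<Sum>x\<in>(UNIV::'a set). x) = (\<Sum>x\<in>(UNIV::'a set). x + 1)"
    by (rule sum.reindex_bij_witness[of _ "\<lambda>x. x + 1" "\<lambda>x. x - 1"]) auto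
  also have "\<dots> = (\<Sum>x\<in>(UNIV::'a set). x) + of_nat CARD('a)"
    by (simp add: sum.distrib)
  finally have "of_nat CARD('a) = (0::'a)" by simp
  then have "(2::'a) ^ n = 0" using assms by simp
  then show ?thesis by simp
qed

lemma vector_space_f2_scale:
  assumes "CARD('a::{field,finite}) = 2 ^ n"
  shows "vector_space (f2_scale :: bit \<Rightarrow> 'a \<Rightarrow> 'a)"
proof
  fix c d :: bit and x :: 'a
  have "x + x = 0"
    using two_eq_zero_card[OF assms] by (metis mult_2 mult_zero_left)
  then show "f2_scale (c + d) x = f2_scale c x + f2_scale d x"
    by (cases c; cases d) (simp_all add: f2_scale_def)
  show "f2_scale c (f2_scale d x) = f2_scale (c * d) x"
    by (cases c; cases d) (simp_all add: f2_scale_def)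
qed (simp_all add: f2_scale_def distrib_left)

definition f2_subspace :: "'a::field set \<Rightarrow> nat \<Rightarrow> bool" where
  "f2_subspace E k \<longleftrightarrow> module.subspace f2_scale E \<and> vector_space.dim f2_scale E = k"

definition f2_affine_subspace :: "'a::field set \<Rightarrow> nat \<Rightarrow> bool" where
  "f2_affine_subspace S k \<longleftrightarrow> (\<exists>v E. f2_subspace E k \<and> S = (\<lambda>x. v + x) ` E)"

definition sum_free :: "nat \<Rightarrow> ('a::field \<Rightarrow> 'a) \<Rightarrow> bool" where
  "sum_free k F \<longleftrightarrow> (\<forall>S. f2_affine_subspace S k \<longrightarrow> (\<Sum>x\<in>S. F x) \<noteq> 0)"

text \<open>The case distinction only matters for \<open>n = 1\<close>, where the exponent is \<open>0\<close> and
  \<open>0 ^ 0 = 1\<close> would violate the convention \<open>F_inv 0 = 0\<close>.\<close>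

definition F_inv :: "nat \<Rightarrow> 'a::field \<Rightarrow> 'a" where
  "F_inv n x = (if x = 0 then 0 else x ^ (2 ^ n - 2))"

definition splits_completely :: "'a::field poly \<Rightarrow> bool" where
  "splits_completely p \<longleftrightarrow> (\<exists>R. p = Polynomial.smult (lead_coeff p) (\<Prod>r\<in>#R. [:- r, 1:]))"

definition lin_poly :: "nat \<Rightarrow> (nat \<Rightarrow> bit) \<Rightarrow> 'a::field poly" where
  "lin_poly k b = (\<Sum>i=0..k. monom (of_bit (b i)) (2 ^ i))"

definition assoc_poly :: "nat \<Rightarrow> (nat \<Rightarrow> bit) \<Rightarrow> bit poly" where
  "assoc_poly k b = (\<Sum>i=0..k. monom (b i) i)"

text \<open>Row and column indices start at \<open>0\<close>: ones on the subdiagonal, and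
  \<open>b 0, \<dots>, b (k - 1)\<close> in the last column.\<close>

definition companion :: "nat \<Rightarrow> (nat \<Rightarrow> bit) \<Rightarrow> bit mat" where
  "companion k b = mat k k (\<lambda>(i, j). if j = k - 1 then b i else if i = j + 1 then 1 else 0)"

end

theory Submission
  imports Defs
begin

text \<open>
  Substituting the Frobenius map for \<open>X\<close> makes the field a module over \<open>F2[X]\<close>, and the action of
  \<open>P = \<Sum> b\<^sub>i X\<^sup>i\<close> is \<open>x \<mapsto> L(x)\<close>; moreover \<open>X\<^sup>n + 1\<close> acts as zero.  If \<open>P Q = X\<^sup>n + 1\<close>, then the range
  of the action of \<open>Q\<close> lies in the kernel of the action of \<open>P\<close>, so counting (with at most \<open>2\<close> to the
  \<open>deg Q\<close> elements in the kernel of \<open>Q\<close>) gives \<open>L\<close> the full number \<open>2\<^sup>k\<close> of roots.  Conversely, if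
  \<open>L\<close> has \<open>2\<^sup>k\<close> roots, they are also roots of the linearized polynomial of the remainder
  \<open>(X\<^sup>n + 1) mod P\<close>, whose degree is too small unless the remainder is zero.  The companion matrix
  describes multiplication by \<open>X\<close> on \<open>F2[X]/(P)\<close>, so its \<open>n\<close>th power is the identity iff \<open>P\<close> divides
  \<open>X\<^sup>n + 1\<close>.  Finally, if the roots of \<open>L\<close> form the subspace \<open>E\<close>, then the sum of the inverses of the nonzero
  elements of \<open>E\<close> is, up to a nonzero factor, the coefficient \<open>b\<^sub>1\<close> of \<open>X\<^sup>2\<close> in \<open>L\<close>.
\<close>

section \<open>The action of F2[X] on a field, with X acting as squaring\<close>

definition lin_eval :: "bit poly \<Rightarrow> 'a::field \<Rightarrow> 'a" where
  "lin_eval p x = (\<Sum>i\<le>degree p. of_bit (poly.coeff p i) * x ^ (2 ^ i))"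

text \<open>The library has this only for the type class \<open>finite_field\<close>, to which \<open>{field,finite}\<close> does not
  belong.\<close>

lemma power_CARD_eq_same: "(x :: 'a::{field,finite}) ^ CARD('a) = x"
proof (cases "x = 0")
  case False
  have "(\<Prod>y\<in>UNIV - {0}. x * y) = (\<Prod>y\<in>UNIV - {0}. y)"
    by (rule prod.reindex_bij_witness[of _ "\<lambda>y. y / x" "\<lambda>y. x * y"]) (use False in auto)
  then have "x ^ card (UNIV - {0 :: 'a}) = 1"
    by (simp add: prod.distrib)
  then show ?thesis
    by (simp add: card_Diff_singleton power_eq_if)
qed (simp add: power_0_left)

lemma of_bit_add: "(2::'a::field) = 0 \<Longrightarrow> of_bit (c + d) = (of_bit c + of_bit d :: 'a)"
  by (cases c; cases d) simp_all

lemma lin_eval_altdef: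
  assumes "degree p \<le> m"
  shows "lin_eval p x = (\<Sum>i\<le>m. of_bit (poly.coeff p i) * x ^ (2 ^ i))"
  unfolding lin_eval_def
  by (rule sum.mono_neutral_left) (use assms in \<open>auto simp: coeff_eq_0\<close>)

lemma lin_eval_0 [simp]: "lin_eval 0 x = 0"
  by (simp add: lin_eval_def)

text \<open>Horner's rule: raising every index by one amounts to one squaring of the argument. This
  recursion drives the inductions below.\<close>

lemma lin_eval_pCons: "lin_eval (pCons a p) x = of_bit a * x + lin_eval p (x ^ 2)"
proof -
  have "lin_eval (pCons a p) x
      = (\<Sum>i\<le>Suc (degree p). of_bit (poly.coeff (pCons a p) i) * x ^ (2 ^ i))"
    by (rule lin_eval_altdef) (simp add: degree_pCons_le)
  also have "\<dots> = of_bit a * x + lin_eval p (x ^ 2)"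
    unfolding sum.atMost_Suc_shift lin_eval_def by (simp add: power_mult)
  finally show ?thesis .
qed

lemma lin_eval_add:
  assumes "(2::'a::field) = 0"
  shows "lin_eval (p + q) (x::'a) = lin_eval p x + lin_eval q x"
proof -
  define m where "m = max (degree p) (degree q)"
  have "degree p \<le> m" "degree q \<le> m" "degree (p + q) \<le> m"
    by (auto simp: m_def intro: degree_add_le)
  then show ?thesis
    by (simp only: lin_eval_altdef coeff_add of_bit_add[OF assms] distrib_right sum.distrib)
qed

lemma lin_eval_smult: "lin_eval (Polynomial.smult c p) x = of_bit c * lin_eval p x"
  by (cases c) auto

lemma square_add_char_2:
  assumes "(2::'a::field) = 0"
  shows "(x + y :: 'a) ^ 2 = x ^ 2 + y ^ 2"
  using assms by (simp add: power2_sum)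

lemma lin_eval_additive:
  assumes "(2::'a::field) = 0"
  shows "lin_eval p (x + y :: 'a) = lin_eval p x + lin_eval p y"
  by (induction p arbitrary: x y)
    (simp_all add: lin_eval_pCons square_add_char_2[OF assms] algebra_simps)

text \<open>The coefficients lie in F2 and are fixed by squaring, so the action commutes with
  Frobenius; this is what turns products into compositions in \<open>lin_eval_mult\<close>.\<close>

lemma lin_eval_square:
  assumes "(2::'a::field) = 0"
  shows "lin_eval p (x ^ 2 :: 'a) = lin_eval p x ^ 2"
proof (induction p arbitrary: x)
  case (pCons a p)
  then show ?case
    using pCons.IH[of "x ^ 2"]
    by (cases a) (simp_all add: lin_eval_pCons square_add_char_2[OF assms])
qed simp

lemma lin_eval_mult:
  assumes "(2::'a::field) = 0"
  shows "lin_eval (p * q) (x::'a) = lin_eval p (lin_eval q x)"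
  by (induction p arbitrary: x)
    (simp_all add: lin_eval_pCons lin_eval_add[OF assms] lin_eval_smult lin_eval_square[OF assms])

lemma lin_eval_monom: "lin_eval (monom 1 m) x = x ^ (2 ^ m)"
  by (induction m arbitrary: x)
    (simp_all add: lin_eval_pCons monom_0 monom_Suc power_mult)

lemma lin_eval_at_0 [simp]: "lin_eval p 0 = 0"
  by (induction p) (simp_all add: lin_eval_pCons)

section \<open>Linearized polynomials and counting their roots\<close>

lemma poly_lin_poly: "degree p \<le> k \<Longrightarrow> poly (lin_poly k (poly.coeff p)) x = lin_eval p x"
  by (simp add: lin_poly_def poly_sum poly_monom lin_eval_altdef atLeast0AtMost)

lemma coeff_lin_poly_power: "i \<le> k \<Longrightarrow> poly.coeff (lin_poly k b) (2 ^ i) = of_bit (b i)"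
  by (simp add: lin_poly_def coeff_sum)

lemma degree_lin_poly_le: "degree (lin_poly k b) \<le> 2 ^ k"
  unfolding lin_poly_def
  by (intro degree_sum_le) (auto intro!: order.trans[OF degree_monom_le] power_increasing)

lemma degree_lin_poly: "b k = 1 \<Longrightarrow> degree (lin_poly k b :: 'a::field poly) = 2 ^ k"
  by (intro antisym degree_lin_poly_le le_degree) (simp add: coeff_lin_poly_power)

lemma lead_coeff_lin_poly: "b k = 1 \<Longrightarrow> lead_coeff (lin_poly k b :: 'a::field poly) = 1"
  by (simp add: degree_lin_poly coeff_lin_poly_power)

lemma coeff_assoc_poly: "poly.coeff (assoc_poly k b) i = (if i \<le> k then b i else 0)"
  by (simp add: assoc_poly_def coeff_sum)

lemma degree_assoc_poly: "b k = 1 \<Longrightarrow> degree (assoc_poly k b) = k"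
  by (intro antisym degree_le le_degree) (auto simp: coeff_assoc_poly)

lemma poly_lin_poly_assoc:
  "b k = 1 \<Longrightarrow> poly (lin_poly k b) x = lin_eval (assoc_poly k b) x"
  by (subst poly_lin_poly[symmetric, of _ k])
    (auto simp: degree_assoc_poly lin_poly_def coeff_assoc_poly)

lemma eq_0_if_lin_eval_many_roots:
  assumes "degree p < k" "finite S" "2 ^ k \<le> card S" "\<And>x::'a::field. x \<in> S \<Longrightarrow> lin_eval p x = 0"
  shows "p = 0"
proof -
  define L where "L = (lin_poly (degree p) (poly.coeff p) :: 'a poly)"
  have "degree L < 2 ^ k"
    using assms(1) degree_lin_poly_le[of "degree p" "poly.coeff p", where ?'a = 'a]
    by (simp add: L_def)
      (meson le_less_trans one_less_numeral_iff power_strict_increasing semiring_norm(76))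
  then have "L = 0"
    using assms by (intro poly_eqI_degree[where A = S]) (auto simp: L_def poly_lin_poly)
  then have "of_bit (lead_coeff p) = (0::'a)"
    using coeff_lin_poly_power[of "degree p" "degree p" "poly.coeff p", where ?'a = 'a]
    by (simp add: L_def)
  then show ?thesis
    by (cases "lead_coeff p") auto
qed

text \<open>Each fibre over the range injects into the kernel by subtracting a fixed
  preimage.\<close>

lemma card_UNIV_le_range_times_kernel:
  fixes f :: "'a::{ab_group_add, finite} \<Rightarrow> 'b::ab_group_add"
  assumes add: "\<And>x y. f (x + y) = f x + f y"
  shows "CARD('a) \<le> card (range f) * card {x. f x = 0}"
proof -
  have diff: "f (x - y) = f x - f y" for x y
    using add[of "x - y" y] by simp
  have "card {x. f x = f y} \<le> card {x. f x = 0}" for y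
    by (rule card_inj_on_le[of "\<lambda>x. x - y"]) (auto simp: diff inj_on_def)
  moreover have "UNIV = (\<Union>z\<in>range f. {x. f x = z})"
    by auto
  then have "CARD('a) \<le> (\<Sum>z\<in>range f. card {x. f x = z})"
    by (metis card_UN_le finite finite_imageI)
  ultimately show ?thesis
    by (intro order.trans[OF \<open>CARD('a) \<le> _\<close>] sum_bounded_above[THEN order.trans]) auto
qed

lemma card_lin_eval_roots_le:
  assumes "p \<noteq> 0"
  shows "card {x::'a::{field,finite}. lin_eval p x = 0} \<le> 2 ^ degree p"
proof (rule ccontr)
  define q where "q = (lin_poly (degree p) (poly.coeff p) :: 'a poly)"
  assume "\<not> ?thesis"
  \<comment> \<open>A nonzero leading coefficient in F2 is 1, so the linearized polynomial is monic
    of degree exactly \<open>2 ^ degree p\<close>.\<close>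
  moreover have "poly.coeff p (degree p) = 1"
    using assms by (metis bit_not_zero_iff leading_coeff_0_iff)
  then have "q \<noteq> 0" "degree q = 2 ^ degree p"
    using lead_coeff_lin_poly[of "poly.coeff p" "degree p", where ?'a = 'a]
      degree_lin_poly[of "poly.coeff p" "degree p", where ?'a = 'a]
    by (auto simp: q_def)
  ultimately show False
    using card_poly_roots_bound[of q] by (simp add: q_def poly_lin_poly)
qed

lemma card_roots_lin_poly_iff_dvd:
  assumes card: "CARD('a::{field,finite}) = 2 ^ n" and n: "n \<ge> 1" and bk: "b k = 1"
  shows "card {x::'a. poly (lin_poly k b) x = 0} = 2 ^ k \<longleftrightarrow> assoc_poly k b dvd monom 1 n + 1"
proof -
  define P where "P = assoc_poly k b"
  have two: "(2::'a) = 0"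
    using card by (rule two_eq_zero_card)
  have add_self: "x + x = 0" for x :: 'a
    using two by (metis mult_2 mult_zero_left)
  have K: "{x::'a. poly (lin_poly k b) x = 0} = {x. lin_eval P x = 0}"
    by (simp add: P_def poly_lin_poly_assoc bk)
  have degP: "degree P = k" "P \<noteq> 0"
    using degree_assoc_poly[of b k] coeff_assoc_poly[of k b k] bk by (auto simp: P_def)
  have "lin_eval (1 :: bit poly) x = x" for x :: 'a
    using lin_eval_monom[of 0 x] by simp
  moreover have "x ^ 2 ^ n = x" for x :: 'a
    using power_CARD_eq_same[of x] card by simp
  \<comment> \<open>\<open>X^n\<close> acts as the identity, so \<open>X^n + 1\<close> acts as
    \<open>x + x\<close>, which is 0 in characteristic 2.\<close>
  ultimately have X: "lin_eval (monom 1 n + 1) x = 0" for x :: 'a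
    by (simp add: lin_eval_add[OF two] lin_eval_monom add_self)
  have degX: "degree (monom 1 n + 1 :: bit poly) = n"
    using n by (subst degree_add_eq_left) (auto simp: degree_monom_eq)
  show ?thesis
    unfolding K P_def[symmetric]
  proof
    assume "P dvd monom 1 n + 1"
    then obtain Q where Q: "monom 1 n + 1 = P * Q" ..
    have "P * Q \<noteq> 0"
      using degX n Q by auto
    then have "Q \<noteq> 0" and n_eq: "n = k + degree Q"
      using degX degP by (auto simp: Q degree_mult_eq)
    have "range (lin_eval Q) \<subseteq> {x::'a. lin_eval P x = 0}"
      using X by (auto simp: Q lin_eval_mult[OF two])
    then have "card (range (lin_eval Q :: 'a \<Rightarrow> 'a)) \<le> card {x::'a. lin_eval P x = 0}"
      by (intro card_mono) auto
    moreover have "CARD('a) \<le> card (range (lin_eval Q :: 'a \<Rightarrow> 'a)) * card {x::'a. lin_eval Q x = 0}"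
      by (rule card_UNIV_le_range_times_kernel) (rule lin_eval_additive[OF two])
    moreover have "card {x::'a. lin_eval Q x = 0} \<le> 2 ^ degree Q"
      using \<open>Q \<noteq> 0\<close> by (rule card_lin_eval_roots_le)
    \<comment> \<open>The range of Q sits inside the kernel of P, so the field size
      \<open>2 ^ n = 2 ^ k * 2 ^ degree Q\<close> is at most the kernel size of P times that of
      Q.\<close>
    ultimately have "2 ^ k * 2 ^ degree Q \<le> card {x::'a. lin_eval P x = 0} * 2 ^ degree Q"
      unfolding card n_eq power_add by (meson mult_le_mono order.trans)
    then have "2 ^ k \<le> card {x::'a. lin_eval P x = 0}"
      by simp
    then show "card {x::'a. lin_eval P x = 0} = 2 ^ k"
      using card_lin_eval_roots_le[OF degP(2), where ?'a = 'a] degP(1) by simp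
  next
    assume *: "card {x::'a. lin_eval P x = 0} = 2 ^ k"
    define R where "R = (monom 1 n + 1 :: bit poly) mod P"
    \<comment> \<open>On the kernel of P the multiple of P in the division acts as zero, so R acts
      there like \<open>X^n + 1\<close>.\<close>
    have "lin_eval R x = 0" if "lin_eval P x = 0" for x :: 'a
    proof -
      have "(monom 1 n + 1) = ((monom 1 n + 1) div P) * P + R"
        by (simp add: R_def)
      then show ?thesis
        using X[of x] that by (metis lin_eval_add[OF two] lin_eval_mult[OF two] lin_eval_at_0 add_0)
    qed
    moreover have "R = 0 \<or> degree R < k"
      using degree_mod_less[OF degP(2)] by (simp add: R_def degP)
    ultimately have "R = 0"
      using eq_0_if_lin_eval_many_roots[of R k "{x::'a. lin_eval P x = 0}"] * by auto
    then show "P dvd monom 1 n + 1"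
      by (auto simp: R_def)
  qed
qed

section \<open>Splitting with simple zeros as a root count\<close>

lemma splits_rsquarefree_iff_card_roots:
  fixes p :: "'a::{field,finite} poly"
  assumes monic: "lead_coeff p = 1"
  shows "splits_completely p \<and> rsquarefree p \<longleftrightarrow> card {x. poly p x = 0} = degree p"
    and "card {x. poly p x = 0} = degree p \<longleftrightarrow> p = (\<Prod>r | poly p r = 0. [:- r, 1:])"
proof -
  define S where "S = {x. poly p x = 0}"
  have deg: "degree (\<Prod>r\<in>S. [:- r, 1:]) = card S"
    by (subst degree_prod_eq_sum_degree) auto
  have lead: "lead_coeff (\<Prod>r\<in>S. [:- r, 1:]) = 1"
    by (simp add: lead_coeff_prod)
  have p0: "p \<noteq> 0"
    using monic by auto
  have prod: "card S = degree p \<longleftrightarrow> p = (\<Prod>r\<in>S. [:- r, 1:])"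
  proof
    assume *: "card S = degree p"
    \<comment> \<open>Both sides are monic of degree \<open>card S\<close> and vanish on
      \<open>S\<close>; the leading terms cancel in the difference, leaving too low a degree for a
      nonzero polynomial with those roots.\<close>
    show "p = (\<Prod>r\<in>S. [:- r, 1:])"
      by (rule poly_eqI_degree_lead_coeff[where n = "degree p" and A = S])
        (use * deg monic lead in \<open>auto simp: poly_prod S_def\<close>)
  qed (use deg in simp)
  then show "card {x. poly p x = 0} = degree p \<longleftrightarrow> p = (\<Prod>r | poly p r = 0. [:- r, 1:])"
    unfolding S_def .
  show "splits_completely p \<and> rsquarefree p \<longleftrightarrow> card {x. poly p x = 0} = degree p"
    unfolding S_def[symmetric]
  proof
    assume *: "splits_completely p \<and> rsquarefree p"
    then obtain R where R: "p = (\<Prod>r\<in>#R. [:- r, 1:])"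
      unfolding splits_completely_def monic by auto
    have order_le: "order a p \<le> 1" for a
      using * unfolding rsquarefree_def by (metis le_refl zero_le_one)
    \<comment> \<open>A repeated entry of \<open>R\<close> would put a squared linear factor into
      \<open>p\<close>, against order at most 1. Hence \<open>R\<close> is just the set of
      roots.\<close>
    have count_le: "count R r \<le> 1" for r
    proof (rule ccontr)
      assume "\<not> count R r \<le> 1"
      then have "replicate_mset 2 r \<subseteq># R"
        by (simp flip: count_le_replicate_mset_subset_eq)
      then obtain R' where "R = replicate_mset 2 r + R'"
        by (metis subset_mset.le_iff_add)
      then have "[:- r, 1:] ^ 2 dvd p"
        by (simp add: R)
      then show False
        using p0 order_le[of r] by (simp add: order_divides)
    qed
    have "R = mset_set (set_mset R)"
    proof (intro multiset_eqI)
      fix r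
      show "count R r = count (mset_set (set_mset R)) r"
        using count_le[of r] by (cases "r \<in># R") (simp_all add: le_Suc_eq count_eq_zero_iff)
    qed
    moreover have "S = set_mset R"
      by (auto simp: S_def R poly_prod_mset)
    ultimately have "p = (\<Prod>r\<in>S. [:- r, 1:])"
      by (metis R prod_unfold_prod_mset)
    then show "card S = degree p"
      using prod by simp
  next
    assume *: "card S = degree p"
    then have "splits_completely p"
      using prod monic unfolding splits_completely_def
      by (intro exI[of _ "mset_set S"]) (simp flip: prod_unfold_prod_mset)
    moreover have "order a p \<le> 1" for a
    proof (rule ccontr)
      assume "\<not> order a p \<le> 1"
      then have "[:- a, 1:] ^ 2 dvd p"
        by (simp add: order_divides)
      then obtain q where q: "p = [:- a, 1:] ^ 2 * q" ..
      then have "q \<noteq> 0"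
        using p0 by auto
      then have "degree p = 2 + degree q"
        unfolding q by (subst degree_mult_eq) (auto simp: degree_power_eq)
      \<comment> \<open>A double zero costs a root: \<open>p\<close> has at most
        \<open>1 + degree q\<close> distinct zeros but degree \<open>2 + degree q\<close>.\<close>
      moreover have "S \<subseteq> insert a {x. poly q x = 0}"
        by (auto simp: S_def q)
      then have "card S \<le> card (insert a {x. poly q x = 0})"
        by (intro card_mono) auto
      then have "card S \<le> Suc (degree q)"
        using card_poly_roots_bound[OF \<open>q \<noteq> 0\<close>] by (simp add: card_insert_if split: if_splits)
      ultimately show False
        using * by simp
    qed
    then have "rsquarefree p"
      using p0 unfolding rsquarefree_def by (metis One_nat_def le_Suc_eq le_zero_eq)
    ultimately show "splits_completely p \<and> rsquarefree p" ..
  qed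
qed

section \<open>F2-subspaces and their cardinalities\<close>

text \<open>Adjoining an independent vector \<open>a\<close> doubles the span: the scalars are 0 and
  1, so the new span is the disjoint union of the old one and its translate by
  \<open>a\<close>.\<close>

lemma card_f2_subspace:
  assumes card: "CARD('a::{field,finite}) = 2 ^ n" and E: "f2_subspace (E :: 'a set) k"
  shows "card E = 2 ^ k"
proof -
  interpret vector_space "f2_scale :: bit \<Rightarrow> 'a \<Rightarrow> 'a"
    using card by (rule vector_space_f2_scale)
  have span: "independent B \<Longrightarrow> card (span B) = 2 ^ card B" if "finite B" for B :: "'a set"
    using that
  proof (induction B)
    case (insert a B)
    have ind: "independent B" "a \<notin> span B"
      using insert by (auto simp: independent_insert)
    have "span (insert a B) = span B \<union> (\<lambda>x. x + a) ` span B"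
    proof (intro Set.set_eqI iffI)
      fix x assume "x \<in> span (insert a B)"
      then obtain c where "x - f2_scale c a \<in> span B"
        by (auto simp: span_insert)
      then show "x \<in> span B \<union> (\<lambda>x. x + a) ` span B"
        by (cases c) (auto simp: f2_scale_def image_iff intro!: bexI[of _ "x - a"])
    next
      fix x assume "x \<in> span B \<union> (\<lambda>x. x + a) ` span B"
      then show "x \<in> span (insert a B)"
        by (auto intro: span_add span_base span_mono[THEN subsetD, of B])
    qed
    moreover have "x + a \<notin> span B" if "x \<in> span B" for x
      using ind(2) span_diff[OF _ that, of "x + a"] by auto
    then have "span B \<inter> (\<lambda>x. x + a) ` span B = {}"
      by auto
    ultimately show ?case
      using insert ind by (simp add: card_Un_disjoint card_image)
  qed simp
  have sub: "subspace E" and dim: "dim E = k"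
    using E by (auto simp: f2_subspace_def)
  obtain B where B: "B \<subseteq> E" "independent B" "E \<subseteq> span B" "card B = dim E"
    using basis_exists by blast
  then have "span B = E"
    using sub span_minimal by blast
  then show ?thesis
    using span[of B] B dim by simp
qed

text \<open>With only the scalars 0 and 1, closure under addition and containing 0 give a subspace,
  and its cardinality determines the dimension.\<close>

lemma f2_subspaceI:
  assumes card: "CARD('a::{field,finite}) = 2 ^ n" and "0 \<in> (E :: 'a set)"
    and "\<And>x y. x \<in> E \<Longrightarrow> y \<in> E \<Longrightarrow> x + y \<in> E" and "card E = 2 ^ k"
  shows "f2_subspace E k"
proof -
  interpret vector_space "f2_scale :: bit \<Rightarrow> 'a \<Rightarrow> 'a"
    using card by (rule vector_space_f2_scale)
  have "f2_scale c x \<in> E" if "x \<in> E" for c x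
    using that assms(2) by (cases c) (simp_all add: f2_scale_def)
  then have "subspace E"
    using assms by (simp add: subspace_def)
  then have "f2_subspace E (dim E)"
    by (simp add: f2_subspace_def)
  moreover have "dim E = k"
    using card_f2_subspace[OF card \<open>f2_subspace E (dim E)\<close>] assms(4) by simp
  ultimately show ?thesis
    by simp
qed

lemma f2_subspace_roots_lin_poly:
  assumes card: "CARD('a::{field,finite}) = 2 ^ n" and bk: "b k = 1"
    and roots: "card {x::'a. poly (lin_poly k b) x = 0} = 2 ^ k"
  shows "f2_subspace {x::'a. poly (lin_poly k b) x = 0} k"
    and "lin_poly k b = (\<Prod>u | poly (lin_poly k b) (u::'a) = 0. [:u, 1:])"
proof -
  have two: "(2::'a) = 0"
    using card by (rule two_eq_zero_card)
  then have minus: "- u = u" for u :: 'a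
    by (metis add_eq_0_iff mult_2 mult_zero_left)
  show "lin_poly k b = (\<Prod>u | poly (lin_poly k b) (u::'a) = 0. [:u, 1:])"
    using splits_rsquarefree_iff_card_roots(2)[OF lead_coeff_lin_poly[where b = b and k = k, OF bk],
        where ?'a = 'a] roots
    unfolding minus degree_lin_poly[where b = b and k = k, OF bk] by blast
  show "f2_subspace {x::'a. poly (lin_poly k b) x = 0} k"
    by (rule f2_subspaceI[OF card _ _ roots])
      (auto simp: poly_lin_poly_assoc bk lin_eval_additive[OF two])
qed

lemma card_roots_lin_poly_iff_subspace:
  assumes card: "CARD('a::{field,finite}) = 2 ^ n" and bk: "b k = 1"
  shows "card {x::'a. poly (lin_poly k b) x = 0} = 2 ^ k
    \<longleftrightarrow> (\<exists>E :: 'a set. f2_subspace E k \<and> lin_poly k b = (\<Prod>u\<in>E. [:u, 1:]))"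
proof
  assume "card {x::'a. poly (lin_poly k b) x = 0} = 2 ^ k"
  then show "\<exists>E :: 'a set. f2_subspace E k \<and> lin_poly k b = (\<Prod>u\<in>E. [:u, 1:])"
    using f2_subspace_roots_lin_poly[where b = b and k = k, OF card bk] by blast
next
  assume "\<exists>E :: 'a set. f2_subspace E k \<and> lin_poly k b = (\<Prod>u\<in>E. [:u, 1:])"
  then obtain E :: "'a set" where E: "f2_subspace E k" "lin_poly k b = (\<Prod>u\<in>E. [:u, 1:])"
    by blast
  \<comment> \<open>In characteristic 2 the factor \<open>X + u\<close> vanishes exactly at
    \<open>u\<close>, so \<open>E\<close> is recovered as the set of roots.\<close>
  have "u + x = 0 \<longleftrightarrow> x = u" for u x :: 'a
    using two_eq_zero_card[OF card] by (metis add_eq_0_iff mult_2 mult_zero_left add_left_cancel)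
  then have "{x. poly (lin_poly k b) x = 0} = E"
    by (auto simp: E(2) poly_prod)
  then show "card {x::'a. poly (lin_poly k b) x = 0} = 2 ^ k"
    using card_f2_subspace[OF card E(1)] by simp
qed

section \<open>The companion matrix as multiplication by X modulo P\<close>

lemma companion_pow_eq_one_iff:
  assumes k: "k \<ge> 1" and bk: "b k = 1"
  shows "companion k b ^\<^sub>m n = 1\<^sub>m k \<longleftrightarrow> assoc_poly k b dvd monom 1 n + 1"
proof -
  define P where "P = assoc_poly k b"
  define A where "A = companion k b"
  \<comment> \<open>Coordinates of the residue class of \<open>p\<close> in the basis
    \<open>1, X, ..., X^(k-1)\<close> of F2[X]/(P).\<close>
  define v where "v p = vec k (poly.coeff (p mod P))" for p
  have P: "degree P = k" "P \<noteq> 0" "lead_coeff P = 1"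
    using degree_assoc_poly[of b k] coeff_assoc_poly[of k b k] bk by (auto simp: P_def)
  have A: "A \<in> carrier_mat k k"
    by (simp add: A_def companion_def)
  have v_carrier [simp]: "v p \<in> carrier_vec k" for p
    by (simp add: v_def)
  have deg_less: "degree (p mod P) < k" for p
    using degree_mod_less[OF P(2), of p] P k by auto
  have bit_minus: "x - y = x + y" for x y :: bit
    by (cases x; cases y) simp_all
  have step: "A *\<^sub>v v p = v (pCons 0 p)" for p
  proof (rule eq_vecI)
    fix i assume "i < dim_vec (v (pCons 0 p))"
    then have i: "i < k" by (simp add: v_def)
    define r where "r = p mod P"
    obtain m where m: "k = Suc m"
      using k by (cases k) auto
    have "(A *\<^sub>v v p) $ i
        = (\<Sum>j<k. (if j = k - 1 then b i else if i = j + 1 then 1 else 0) * poly.coeff r j)"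
      using i by (simp add: A_def companion_def v_def scalar_prod_def r_def atLeast0LessThan)
    also have "\<dots> = (\<Sum>j<m. if i = j + 1 then poly.coeff r j else 0) + b i * poly.coeff r m"
      unfolding m sum.lessThan_Suc by (intro arg_cong2[where f = "(+)"] sum.cong) auto
    also have "(\<Sum>j<m. if i = j + 1 then poly.coeff r j else 0) = poly.coeff (pCons 0 r) i"
    proof (cases i)
      case (Suc i')
      then show ?thesis using i m by (simp add: sum.delta')
    qed simp
    also have "poly.coeff (pCons 0 r) i + b i * poly.coeff r m
        = poly.coeff (pCons 0 r - Polynomial.smult (poly.coeff r (k - 1)) P) i"
      using less_imp_le[OF i]
      by (simp only: m coeff_diff coeff_smult bit_minus P_def coeff_assoc_poly diff_Suc_1 if_True
          mult.commute)
    \<comment> \<open>\<open>X r\<close> has degree at most \<open>k\<close> and P is monic of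
      degree \<open>k\<close>, so subtracting one scalar multiple of P completes the
      reduction.\<close>
    also have "pCons 0 r - Polynomial.smult (poly.coeff r (k - 1)) P = pCons 0 p mod P"
      using mod_pCons[OF P(2), of 0 p] P k by (simp add: r_def coeff_pCons split: nat.split)
    finally show "(A *\<^sub>v v p) $ i = v (pCons 0 p) $ i"
      using i by (simp add: v_def)
  qed (simp_all add: v_def A_def companion_def)
  have pow: "(A ^\<^sub>m m) *\<^sub>v v p = v (monom 1 m * p)" for m p
  proof (induction m arbitrary: p)
    case 0
    then show ?case using A by (simp add: monom_0)
  next
    case (Suc m)
    have "(A ^\<^sub>m Suc m) *\<^sub>v v p = (A ^\<^sub>m m) *\<^sub>v (A *\<^sub>v v p)"
      using A by (simp add: assoc_mult_mat_vec[of _ k k _ k])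
    also have "\<dots> = v (monom 1 (Suc m) * p)"
      by (simp add: step Suc monom_Suc)
    finally show ?case .
  qed
  have v_eq_iff: "v p = v q \<longleftrightarrow> P dvd p + q" for p q
  proof -
    have "v p = v q \<longleftrightarrow> p mod P = q mod P"
    proof
      assume *: "v p = v q"
      show "p mod P = q mod P"
      proof (rule poly_eqI)
        fix i
        show "poly.coeff (p mod P) i = poly.coeff (q mod P) i"
        proof (cases "i < k")
          case True
          then show ?thesis using arg_cong[OF *, of "\<lambda>w. w $ i"] by (simp add: v_def)
        next
          case False
          then show ?thesis
            using deg_less[of p] deg_less[of q] by (simp add: coeff_eq_0)
        qed
      qed
    qed (simp add: v_def)
    also have "\<dots> \<longleftrightarrow> P dvd p - q"
      by (rule mod_eq_dvd_iff)
    also have "p - q = p + q"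
      by (rule poly_eqI) simp
    finally show ?thesis .
  qed
  have unit: "v (monom 1 j) = unit_vec k j" if "j < k" for j
    using that P by (auto simp: v_def mod_poly_less degree_monom_eq unit_vec_def)
  show ?thesis
    unfolding A_def[symmetric] P_def[symmetric]
  proof
    assume "A ^\<^sub>m n = 1\<^sub>m k"
    \<comment> \<open>Applying both matrices to the class of 1 gives \<open>X^n = 1\<close> modulo
      P.\<close>
    then have "v (monom 1 n * 1) = v 1"
      using pow[of n 1] by simp
    then show "P dvd monom 1 n + 1"
      by (simp add: v_eq_iff)
  next
    assume dvd: "P dvd monom 1 n + 1"
    show "A ^\<^sub>m n = 1\<^sub>m k"
    proof (rule eq_matI)
      fix i j assume "i < dim_row (1\<^sub>m k)" "j < dim_col (1\<^sub>m k)"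
      then have ij: "i < k" "j < k" by auto
      \<comment> \<open>Column \<open>j\<close> of \<open>A^n\<close> is the coordinate vector of
        \<open>X^n X^j\<close>, which modulo P is \<open>X^j\<close>, the basis vector of index
        \<open>j\<close>.\<close>
      have "P dvd (monom 1 n + 1) * monom 1 j"
        using dvd by (rule dvd_mult2)
      then have "(A ^\<^sub>m n) *\<^sub>v v (monom 1 j) = v (monom 1 j)"
        by (simp add: pow v_eq_iff distrib_right)
      then have "((A ^\<^sub>m n) *\<^sub>v unit_vec k j) $ i = unit_vec k j $ i"
        using ij by (simp add: unit)
      then show "(A ^\<^sub>m n) $$ (i, j) = 1\<^sub>m k $$ (i, j)"
        using ij A by (simp add: scalar_prod_right_unit)
    qed (use A in auto)
  qed
qed

section \<open>Sums of inverses and the failure of sum-freeness\<close>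

text \<open>Logarithmic derivative at 0: if the product is \<open>X Q\<close>, then
  \<open>Q'(0) / Q(0)\<close> is the sum of the inverses, and \<open>Q'(0)\<close> is the
  coefficient of X in \<open>Q\<close>, hence of \<open>X^2\<close> in the product.\<close>

lemma sum_inverse_roots_eq_0:
  fixes E :: "'a::field set"
  assumes "finite E" "0 \<in> E" and "poly.coeff (\<Prod>u\<in>E. [:u, 1:]) 2 = 0"
  shows "(\<Sum>u\<in>E - {0}. inverse u) = 0"
proof -
  define Q where "Q = (\<Prod>u\<in>E - {0}. [:u, 1:])"
  have "(\<Prod>u\<in>E. [:u, 1:]) = pCons 0 Q"
    using assms(1,2) by (simp add: Q_def prod.remove[of E 0])
  then have "poly.coeff Q 1 = 0"
    using assms(3) by (simp add: numeral_2_eq_2)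
  then have "poly (pderiv Q) 0 = 0"
    by (simp add: poly_0_coeff_0 coeff_pderiv)
  moreover have "poly (pderiv Q) 0 = (\<Sum>u\<in>E - {0}. \<Prod>v\<in>E - {0} - {u}. v)"
    by (simp add: Q_def pderiv_prod poly_sum poly_prod pderiv_pCons)
  moreover have "\<dots> = (\<Sum>u\<in>E - {0}. inverse u * (\<Prod>v\<in>E - {0}. v))"
    using assms(1) by (intro sum.cong) (auto simp: prod.remove[of "E - {0}"])
  ultimately have "(\<Sum>u\<in>E - {0}. inverse u) * (\<Prod>v\<in>E - {0}. v) = 0"
    by (simp add: sum_distrib_right)
  then show ?thesis
    using assms(1) by auto
qed

lemma F_inv_eq_inverse:
  assumes card: "CARD('a::{field,finite}) = 2 ^ n" and n: "n \<ge> 1"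
  shows "F_inv n (x::'a) = inverse x"
proof (cases "x = 0")
  case False
  \<comment> \<open>This makes the truncated subtraction in the exponent \<open>2 ^ n - 2\<close>
    exact.\<close>
  have "(2::nat) ^ 1 \<le> 2 ^ n"
    using n by (intro power_increasing) auto
  then have "x * (x * x ^ (2 ^ n - 2)) = x ^ 2 ^ n"
    by (metis power_add power2_eq_square mult.assoc le_add_diff_inverse power_one_right)
  also have "\<dots> = x * 1"
    using power_CARD_eq_same[of x] card by simp
  finally show ?thesis
    using False by (simp add: F_inv_def inverse_unique)
qed (simp add: F_inv_def)

lemma not_sum_free_F_inv:
  assumes card: "CARD('a::{field,finite}) = 2 ^ n" and n: "n \<ge> 1" and k: "k \<ge> 1"
    and a: "a k = 1" "a 1 = 0" "assoc_poly k a dvd monom 1 n + 1"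
  shows "\<not> sum_free k (F_inv n :: 'a \<Rightarrow> 'a)"
proof -
  define E where "E = {x::'a. poly (lin_poly k a) x = 0}"
  have roots: "card {x::'a. poly (lin_poly k a) x = 0} = 2 ^ k"
    using card_roots_lin_poly_iff_dvd[where b = a and k = k, OF card n a(1)] a(3) by simp
  have E: "f2_subspace E k" "lin_poly k a = (\<Prod>u\<in>E. [:u, 1:])"
    unfolding E_def using f2_subspace_roots_lin_poly[where b = a and k = k, OF card a(1) roots] .
  \<comment> \<open>\<open>X^2\<close> is the linearized term of index 1, which is in range because
    \<open>k >= 1\<close>.\<close>
  have "poly.coeff (lin_poly k a :: 'a poly) 2 = 0"
    using coeff_lin_poly_power[OF k, of a] a(2) by simp
  moreover have "0 \<in> E"
    by (simp add: E_def poly_lin_poly_assoc a(1))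
  ultimately have "(\<Sum>u\<in>E - {0}. inverse u) = 0"
    using sum_inverse_roots_eq_0[of E] E(2) by simp
  then have "(\<Sum>u\<in>E. F_inv n u) = 0"
    using \<open>0 \<in> E\<close> by (simp add: F_inv_eq_inverse[OF card n] sum.remove[of E 0])
  moreover have "f2_affine_subspace E k"
    unfolding f2_affine_subspace_def using E(1) by (intro exI[of _ 0] exI[of _ E]) simp
  ultimately show ?thesis
    unfolding sum_free_def by blast
qed

theorem theorem2p1:
  fixes n k :: nat and b :: "nat \<Rightarrow> bit"
  assumes card: "CARD('a::{field,finite}) = 2 ^ n"
    and n: "n \<ge> 1" and k: "k \<ge> 1" and bk: "b k = 1"
  shows "(splits_completely (lin_poly k b :: 'a poly) \<and> rsquarefree (lin_poly k b :: 'a poly)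
            \<longleftrightarrow> (\<exists>E :: 'a set. f2_subspace E k \<and> lin_poly k b = (\<Prod>u\<in>E. [:u, 1:])))
       \<and> (splits_completely (lin_poly k b :: 'a poly) \<and> rsquarefree (lin_poly k b :: 'a poly)
            \<longleftrightarrow> companion k b ^\<^sub>m n = 1\<^sub>m k)
       \<and> (companion k b ^\<^sub>m n = 1\<^sub>m k \<longleftrightarrow> assoc_poly k b dvd monom 1 n + 1)
       \<and> ((\<exists>a :: nat \<Rightarrow> bit. a k = 1 \<and> a 1 = 0 \<and> assoc_poly k a dvd monom 1 n + 1)
            \<longrightarrow> \<not> sum_free k (F_inv n :: 'a \<Rightarrow> 'a))"
proof -
  \<comment> \<open>The root count is the common middle term linking splitting, the product over a
    subspace and divisibility.\<close>
  have roots: "splits_completely (lin_poly k b :: 'a poly) \<and> rsquarefree (lin_poly k b :: 'a poly)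
      \<longleftrightarrow> card {x::'a. poly (lin_poly k b) x = 0} = 2 ^ k"
    using splits_rsquarefree_iff_card_roots(1)[OF lead_coeff_lin_poly[where b = b and k = k, OF bk],
        where ?'a = 'a]
    by (simp only: degree_lin_poly[where b = b and k = k, OF bk])
  show ?thesis
    unfolding roots
    using card_roots_lin_poly_iff_subspace[where b = b and k = k, OF card bk]
      card_roots_lin_poly_iff_dvd[where b = b and k = k, OF card n bk]
      companion_pow_eq_one_iff[where b = b and k = k, OF k bk, of n]
      not_sum_free_F_inv[where k = k, OF card n k]
    by blast
qed

end
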